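(* Let $L(z)$ be an $L$-operator over $\mathfrak R$, i.e. an $n\times n$ matrix satisfying the relation $R(z/w)L^{(1)}(z)L^{(2)}(w)=L^{(2)}(w)L^{(1)}(z)R(z/w)$ with the trigonometric $R$-matrix $R$. Then $$M=L(z)\,q^{2z\frac{\partial}{\partial z}}$$ is a $q$-Manin matrix. Also $\widetilde M=L(z)^{\top}q^{-2z\frac{\partial}{\partial z}}$ is a $q$-Manin matrix, where $L(z)^\top$ is the transpose of $L(z)$.
   Context: Let $q$ be a nonzero complex number and $\mathfrak R$ an associative unital, not necessarily commutative, algebra over $\mathbb C$. A matrix $M=(M_{ij})$ over an associative algebra is called $q$-Manin if $M_{ij}M_{kj}=q^{-1}M_{kj}M_{ij}$ for all $j$ and all $i<k$, and $M_{ij}M_{kl}-M_{kl}M_{ij}=q^{-1}M_{kj}M_{il}-q\,M_{il}M_{kj}$ for all $i<k$, $j<l$. The trigonometric $R$-matrix is $$R(z)=\frac1{z-1}\Big((qz-q^{-1})\sum_{i=1}^nE_{ii}\otimes E_{ii}+(z-1)\sum_{i\neq j}E_{ii}\otimes E_{jj}+(q-q^{-1})\sum_{i<j}\big(zE_{ij}\otimes E_{ji}+E_{ji}\otimes E_{ij}\big)\Big)\in\mathrm{End}(\mathbb C^n\otimes\mathbb C^n)(z),$$ where $E_{ij}$ are the matrix units of $\mathrm{End}(\mathbb C^n)$. $L(z)=\sum_{ij}L_{ij}(z)E_{ij}$ is an $n\times n$ matrix whose entries are elements of $\mathfrak R$ depending on the parameter $z$; $L^{(1)}(z)=\sum_{ij}L_{ij}(z)\,E_{ij}\otimes1$,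 $L^{(2)}(w)=\sum_{ij}L_{ij}(w)\,1\otimes E_{ij}$. The operator $q^{\pm2z\frac{\partial}{\partial z}}$ acts by $q^{\pm2z\frac{\partial}{\partial z}}f(z)=f(q^{\pm2}z)$; in the algebra of operators generated by (multiplication by) $\mathfrak R$-valued functions of $z$ and $q^{\pm2z\frac{\partial}{\partial z}}$ one has $q^{\pm2z\frac{\partial}{\partial z}}f(z)=f(q^{\pm2}z)\,q^{\pm2z\frac{\partial}{\partial z}}$, and the entries of $M$, $\widetilde M$ are regarded as elements of this algebra. *)

theory Defs
  imports "HOL-Analysis.Analysis"
begin

text \<open>Associative unital (not necessarily commutative) algebras over the complex numbers; the
  complex analogue of \<^class>\<open>real_algebra_1\<close>.\<close>

class complex_algebra_1 = ring_1 +
  fixes scaleC :: "complex \<Rightarrow> 'a \<Rightarrow> 'a" (infixr \<open>*\<^sub>C\<close> 75)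
  assumes scaleC_add_right: "a *\<^sub>C (x + y) = a *\<^sub>C x + a *\<^sub>C y"
    and scaleC_add_left: "(a + b) *\<^sub>C x = a *\<^sub>C x + b *\<^sub>C x"
    and scaleC_scaleC: "a *\<^sub>C b *\<^sub>C x = (a * b) *\<^sub>C x"
    and scaleC_one: "1 *\<^sub>C x = x"
    and mult_scaleC_left: "a *\<^sub>C x * y = a *\<^sub>C (x * y)"
    and mult_scaleC_right: "x * a *\<^sub>C y = a *\<^sub>C (x * y)"
begin

lemma scaleC_zero_right: "a *\<^sub>C 0 = 0"
  using scaleC_add_right[of a 0 0] by simp

lemma scaleC_minus_right: "a *\<^sub>C (- x) = - (a *\<^sub>C x)"
proof -
  have "a *\<^sub>C (- x) + a *\<^sub>C x = 0"
    by (simp add: scaleC_add_right[symmetric] scaleC_zero_right)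
  then show ?thesis by (simp add: eq_neg_iff_add_eq_0)
qed

lemma scaleC_diff_right: "a *\<^sub>C (x - y) = a *\<^sub>C x - a *\<^sub>C y"
  using scaleC_add_right[of a x "- y"] by (simp add: scaleC_minus_right)

end

definition q_manin ::
  "complex \<Rightarrow> 'a::complex_algebra_1 ^ 'm::{finite,linorder} ^ 'n::{finite,linorder} \<Rightarrow> bool" where
  "q_manin q M \<longleftrightarrow>
     (\<forall>i k j. i < k \<longrightarrow> M$i$j * M$k$j = inverse q *\<^sub>C (M$k$j * M$i$j)) \<and>
     (\<forall>i k j l. i < k \<longrightarrow> j < l \<longrightarrow>
        M$i$j * M$k$l - M$k$l * M$i$j
          = inverse q *\<^sub>C (M$k$j * M$i$l) - q *\<^sub>C (M$i$l * M$k$j))"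

text \<open>The index type of \<open>\<complex>\<^sup>n \<otimes> \<complex>\<^sup>n\<close> is \<open>'n \<times> 'n\<close>, with
  \<open>e\<^sub>a \<otimes> e\<^sub>b\<close> at position \<open>(a, b)\<close>.\<close>

definition matrix_unit :: "'n::finite \<Rightarrow> 'n \<Rightarrow> 'a::zero_neq_one ^ 'n ^ 'n" where
  "matrix_unit i j = (\<chi> a b. if a = i \<and> b = j then 1 else 0)"

definition kronecker :: "'a::times ^ 'n::finite ^ 'n \<Rightarrow> 'a ^ 'n ^ 'n \<Rightarrow> 'a ^ ('n \<times> 'n) ^ ('n \<times> 'n)"
    (infixl \<open>\<otimes>\<^sub>K\<close> 72) where
  "A \<otimes>\<^sub>K B = (\<chi> p s. A $ fst p $ fst s * B $ snd p $ snd s)"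

definition leg1 :: "'r::ring_1 ^ 'n::finite ^ 'n \<Rightarrow> 'r ^ ('n \<times> 'n) ^ ('n \<times> 'n)" where
  "leg1 A = A \<otimes>\<^sub>K mat 1"

definition leg2 :: "'r::ring_1 ^ 'n::finite ^ 'n \<Rightarrow> 'r ^ ('n \<times> 'n) ^ ('n \<times> 'n)" where
  "leg2 A = mat 1 \<otimes>\<^sub>K A"

definition trig_R :: "complex \<Rightarrow> complex \<Rightarrow>
    complex ^ ('n \<times> 'n) ^ ('n \<times> 'n::{finite,linorder})" where
  "trig_R q z = map_matrix ((*) (1 / (z - 1)))
     ( map_matrix ((*) (q * z - inverse q)) (\<Sum>i\<in>UNIV. matrix_unit i i \<otimes>\<^sub>K matrix_unit i i)
     + map_matrix ((*) (z - 1)) (\<Sum>(i, j)\<in>{(i, j). i \<noteq> j}. matrix_unit i i \<otimes>\<^sub>K matrix_unit j j)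
     + map_matrix ((*) (q - inverse q))
         (\<Sum>(i, j)\<in>{(i, j). i < j}.
            map_matrix ((*) z) (matrix_unit i j \<otimes>\<^sub>K matrix_unit j i)
            + matrix_unit j i \<otimes>\<^sub>K matrix_unit i j))"

text \<open>The \<open>R\<close>-matrix is a rational function of its argument, so \<open>R(z/w)\<close> is meaningful wherever
  that function is regular, and its value there is the limit \<open>C\<close> below. For an argument other than
  1 this is just \<^term>\<open>trig_R q (z / w)\<close>. At 1 there is a genuine pole, and hence no condition on
  \<open>L\<close>, if \<open>q\<^sup>2 \<noteq> 1\<close>; if \<open>q\<^sup>2 = 1\<close> the singularity is removable, and the relation is also required
  for \<open>z = w\<close>, where \<^const>\<open>trig_R\<close> itself has the junk value coming from \<open>1 / 0 = 0\<close>.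
  The set \<open>D\<close> is the domain of definition of the entries of \<open>L\<close>.\<close>

definition L_operator :: "complex \<Rightarrow> complex set \<Rightarrow>
    (complex \<Rightarrow> 'r::complex_algebra_1 ^ 'n::{finite,linorder} ^ 'n::{finite,linorder}) \<Rightarrow> bool" where
  "L_operator q D L \<longleftrightarrow>
     (\<forall>z\<in>D. \<forall>w\<in>D. \<forall>C. (trig_R q \<longlongrightarrow> C) (at (z / w)) \<longrightarrow>
        map_matrix (\<lambda>c. c *\<^sub>C 1) C ** leg1 (L z) ** leg2 (L w)
          = leg2 (L w) ** leg1 (L z) ** map_matrix (\<lambda>c. c *\<^sub>C 1) C)"

text \<open>The algebra of linear operators on \<open>'r\<close>-valued functions, with composition as product.\<close>

typedef (overloaded) 'r::complex_algebra_1 fun_op =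
  "{A :: (complex \<Rightarrow> 'r) \<Rightarrow> (complex \<Rightarrow> 'r).
      (\<forall>f g. A (\<lambda>z. f z + g z) = (\<lambda>z. A f z + A g z)) \<and>
      (\<forall>c f. A (\<lambda>z. c *\<^sub>C f z) = (\<lambda>z. c *\<^sub>C A f z))}"
  morphisms app_op Abs_fun_op
  by (rule exI[of _ "\<lambda>f. f"]) simp

setup_lifting type_definition_fun_op

instantiation fun_op :: (complex_algebra_1) complex_algebra_1
begin

lift_definition zero_fun_op :: "'a fun_op" is "\<lambda>f z. 0"
  by (simp add: scaleC_zero_right)
lift_definition one_fun_op :: "'a fun_op" is "\<lambda>f. f"
  by simp
lift_definition plus_fun_op :: "'a fun_op \<Rightarrow> 'a fun_op \<Rightarrow> 'a fun_op" is "\<lambda>A B f z. A f z + B f z"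
  by (simp add: scaleC_add_right algebra_simps)
lift_definition minus_fun_op :: "'a fun_op \<Rightarrow> 'a fun_op \<Rightarrow> 'a fun_op" is "\<lambda>A B f z. A f z - B f z"
  by (simp add: scaleC_diff_right algebra_simps)
lift_definition uminus_fun_op :: "'a fun_op \<Rightarrow> 'a fun_op" is "\<lambda>A f z. - A f z"
  by (simp add: scaleC_minus_right)
lift_definition times_fun_op :: "'a fun_op \<Rightarrow> 'a fun_op \<Rightarrow> 'a fun_op" is "\<lambda>A B f. A (B f)"
  by simp
lift_definition scaleC_fun_op :: "complex \<Rightarrow> 'a fun_op \<Rightarrow> 'a fun_op" is "\<lambda>c A f z. c *\<^sub>C A f z"
  by (simp add: scaleC_add_right scaleC_scaleC mult.commute)

instance
proof
  note ext_simps = app_op_inject[symmetric] fun_eq_iff zero_fun_op.rep_eq one_fun_op.rep_eq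
    plus_fun_op.rep_eq minus_fun_op.rep_eq uminus_fun_op.rep_eq times_fun_op.rep_eq
    scaleC_fun_op.rep_eq
  fix A B C :: "'a fun_op" and a b :: complex
  show "A + B + C = A + (B + C)" by (simp add: ext_simps add.assoc)
  show "A + B = B + A" by (simp add: ext_simps add.commute)
  show "0 + A = A" by (simp add: ext_simps)
  show "- A + A = 0" by (simp add: ext_simps)
  show "A - B = A + - B" by (simp add: ext_simps)
  show "A * B * C = A * (B * C)" by (simp add: ext_simps)
  show "1 * A = A" by (simp add: ext_simps)
  show "A * 1 = A" by (simp add: ext_simps)
  show "(A + B) * C = A * C + B * C" by (simp add: ext_simps)
  show "A * (B + C) = A * B + A * C"
    using app_op[of A] by (simp add: ext_simps)
  show "(0 :: 'a fun_op) \<noteq> 1"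
    by (auto simp: ext_simps intro: exI[of _ "\<lambda>_. 1"])
  show "a *\<^sub>C (A + B) = a *\<^sub>C A + a *\<^sub>C B" by (simp add: ext_simps scaleC_add_right)
  show "(a + b) *\<^sub>C A = a *\<^sub>C A + b *\<^sub>C A" by (simp add: ext_simps scaleC_add_left)
  show "a *\<^sub>C b *\<^sub>C A = (a * b) *\<^sub>C A" by (simp add: ext_simps scaleC_scaleC)
  show "1 *\<^sub>C A = A" by (simp add: ext_simps scaleC_one)
  show "a *\<^sub>C A * B = a *\<^sub>C (A * B)" by (simp add: ext_simps)
  show "A * a *\<^sub>C B = a *\<^sub>C (A * B)"
    using app_op[of A] by (simp add: ext_simps)
qed

end

text \<open>A function on \<open>D\<close> is identified with its extension by zero to the whole plane, and an operator
  on functions on \<open>D\<close> accordingly with the operator which restricts a function to \<open>D\<close>, applies the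
  given operator and extends the result by zero. This is an injective algebra homomorphism (only
  the unit is not preserved, being sent to the restriction to \<open>D\<close>). \<open>dilation_op c\<close> is
  \<open>f(z) \<mapsto> f(c z)\<close>, that is \<open>q\<^bsup>\<plusminus>2z\<partial>/\<partial>z\<^esup>\<close> for \<open>c = q\<^bsup>\<plusminus>2\<^esup>\<close>.\<close>

lift_definition mult_op :: "complex set \<Rightarrow> (complex \<Rightarrow> 'r) \<Rightarrow> 'r::complex_algebra_1 fun_op"
  is "\<lambda>D a f z. if z \<in> D then a z * f z else 0"
  by (auto simp: fun_eq_iff distrib_left mult_scaleC_right scaleC_zero_right)

lift_definition dilation_op :: "complex \<Rightarrow> 'r::complex_algebra_1 fun_op"
  is "\<lambda>c f z. f (c * z)"
  by simp

lemma dilation_mult_op: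
  assumes "\<And>z. c * z \<in> D \<longleftrightarrow> z \<in> D"
  shows "dilation_op c * mult_op D a = mult_op D (\<lambda>z. a (c * z)) * dilation_op c"
  using assms by transfer (auto simp: fun_eq_iff)

lemma mult_op_mult: "mult_op D a * mult_op D b = mult_op D (\<lambda>z. a z * b z)"
  by transfer (auto simp: fun_eq_iff mult.assoc)

lemma mult_op_eq_iff: "mult_op D a = mult_op D b \<longleftrightarrow> (\<forall>z\<in>D. a z = b z)"
proof
  assume "mult_op D a = mult_op D b"
  then have eq: "app_op (mult_op D a) (\<lambda>_. 1) z = app_op (mult_op D b) (\<lambda>_. 1) z" for z
    by simp
  show "\<forall>z\<in>D. a z = b z"
  proof
    fix z assume "z \<in> D"
    with eq[of z] show "a z = b z" by (simp add: mult_op.rep_eq)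
  qed
qed (auto simp: app_op_inject[symmetric] mult_op.rep_eq fun_eq_iff)

definition op_matrix :: "complex set \<Rightarrow> (complex \<Rightarrow> 'r ^ 'm ^ 'n) \<Rightarrow> complex
    \<Rightarrow> 'r::complex_algebra_1 fun_op ^ 'm ^ 'n" where
  "op_matrix D A c = (\<chi> i j. mult_op D (\<lambda>z. A z $ i $ j) * dilation_op c)"

end

theory Submission
  imports Defs
begin

text \<open>Let \<open>q\<^sup>2 \<noteq> 1\<close>. At the argument \<open>x = q\<^bsup>-2\<^esup>\<close> the weight \<open>q x - q\<^bsup>-1\<^esup>\<close> of the diagonal positions
  \<open>(a, a)\<close> vanishes and the \<open>R\<close>-matrix degenerates to a multiple of a projection, the
  \<open>q\<close>-antisymmetrizer \<open>P\<close>. If \<open>w = q\<^sup>2 z\<close>, the \<open>RLL\<close> relation therefore becomes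
  \<open>P L\<^sup>1(z) L\<^sup>2(w) = L\<^sup>2(w) L\<^sup>1(z) P\<close> (lemma \<open>L_operator_antisymmetrizer\<close>). On the other hand,
  a product of two entries of \<open>L(z) q\<^bsup>2z\<partial>/\<partial>z\<^esup>\<close> is a product of an entry of \<open>L(z)\<close> and an entry of
  \<open>L(q\<^sup>2 z)\<close>, times a fixed power of the dilation, so that the \<open>q\<close>-Manin relations are relations
  between the entries of \<open>L(z)\<close> and \<open>L(w)\<close> in this order (lemma \<open>q_manin_op_matrixI\<close>).

  The right-hand side of the antisymmetrizer relation contains the products in the opposite order.
  But \<open>P\<close> kills \<open>e\<^sub>c \<otimes> e\<^sub>c\<close>, which gives the relations within a column, and it has rank one on
  the span of \<open>e\<^sub>c \<otimes> e\<^sub>d\<close> and \<open>e\<^sub>d \<otimes> e\<^sub>c\<close> for \<open>c \<noteq> d\<close>: its two columns there are proportional, so that the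
  opposite products can be eliminated from the two corresponding entries of the relation, which gives the cross relations. The statement on \<open>L(z)\<^sup>\<top>\<close> follows in the same way
  from the rows of \<open>P\<close>: now it is the left-hand side that is eliminated.

  If \<open>q\<^sup>2 = 1\<close>, the argument \<open>q\<^bsup>-2\<^esup>\<close> is the point 1, where the singularity of the \<open>R\<close>-matrix is
  removable; its value there is diagonal and does not degenerate. The relation then says that
  entries in different rows and columns commute and that those in a common row or column commute up
  to the sign \<open>q\<close>, which implies the same antisymmetrizer relation.\<close>

section \<open>Scalar multiplication and operators\<close>

lemma scaleC_zero_left: "0 *\<^sub>C (x :: 'a::complex_algebra_1) = 0"
  using scaleC_add_left[of 0 0 x] by simp

lemma scaleC_minus_left: "(- a) *\<^sub>C (x :: 'a::complex_algebra_1) = - (a *\<^sub>C x)"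
  using scaleC_add_left[of a "- a" x] by (simp add: scaleC_zero_left add_eq_0_iff)

lemma mult_op_diff: "mult_op D a - mult_op D b = mult_op D (\<lambda>z. a z - b z)"
  by transfer (auto simp: fun_eq_iff left_diff_distrib)

lemma scaleC_mult_op: "s *\<^sub>C mult_op D a = mult_op D (\<lambda>z. s *\<^sub>C a z)"
  by transfer (auto simp: fun_eq_iff mult_scaleC_left scaleC_zero_right)

lemma op_matrix_mult_entries:
  assumes "\<And>z. c * z \<in> D \<longleftrightarrow> z \<in> D"
  shows "op_matrix D A c $ i $ j * op_matrix D A c $ k $ l
    = mult_op D (\<lambda>z. A z $ i $ j * A (c * z) $ k $ l) * (dilation_op c * dilation_op c)"
proof -
  have "op_matrix D A c $ i $ j * op_matrix D A c $ k $ l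
      = mult_op D (\<lambda>z. A z $ i $ j) * (dilation_op c * mult_op D (\<lambda>z. A z $ k $ l)) * dilation_op c"
    by (simp add: op_matrix_def mult.assoc)
  also have "\<dots> = mult_op D (\<lambda>z. A z $ i $ j) * mult_op D (\<lambda>z. A (c * z) $ k $ l)
      * (dilation_op c * dilation_op c)"
    by (simp only: dilation_mult_op[OF assms] mult.assoc)
  finally show ?thesis
    by (simp only: mult_op_mult)
qed

text \<open>Moving all dilations to the right turns the \<open>q\<close>-Manin relations into identities between
  functions on \<open>D\<close>.\<close>

lemma q_manin_op_matrixI:
  fixes A :: "complex \<Rightarrow> 'r::complex_algebra_1 ^ 'm::{finite,linorder} ^ 'n::{finite,linorder}"
  assumes D: "\<And>z. c * z \<in> D \<longleftrightarrow> z \<in> D"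
    and column: "\<And>z i k j. z \<in> D \<Longrightarrow> i < k \<Longrightarrow>
      A z $ i $ j * A (c * z) $ k $ j = inverse q *\<^sub>C (A z $ k $ j * A (c * z) $ i $ j)"
    and cross: "\<And>z i k j l. z \<in> D \<Longrightarrow> i < k \<Longrightarrow> j < l \<Longrightarrow>
      A z $ i $ j * A (c * z) $ k $ l - A z $ k $ l * A (c * z) $ i $ j
        = inverse q *\<^sub>C (A z $ k $ j * A (c * z) $ i $ l) - q *\<^sub>C (A z $ i $ l * A (c * z) $ k $ j)"
  shows "q_manin q (op_matrix D A c)"
proof -
  have "mult_op D (\<lambda>z. A z $ i $ j * A (c * z) $ k $ j)
      = mult_op D (\<lambda>z. inverse q *\<^sub>C (A z $ k $ j * A (c * z) $ i $ j))" if "i < k" for i k j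
    using column[OF _ that] by (simp add: mult_op_eq_iff)
  moreover have "mult_op D (\<lambda>z. A z $ i $ j * A (c * z) $ k $ l - A z $ k $ l * A (c * z) $ i $ j)
      = mult_op D (\<lambda>z. inverse q *\<^sub>C (A z $ k $ j * A (c * z) $ i $ l)
          - q *\<^sub>C (A z $ i $ l * A (c * z) $ k $ j))" if "i < k" "j < l" for i k j l
    using cross[OF _ that] by (simp add: mult_op_eq_iff)
  ultimately show ?thesis
    by (simp add: q_manin_def op_matrix_mult_entries[OF D] mult_scaleC_left[symmetric]
        left_diff_distrib[symmetric] scaleC_mult_op mult_op_diff)
qed

section \<open>Matrices of the shape of the R-matrix\<close>

text \<open>The row \<open>(a, b)\<close> is supported at the columns \<open>(a, b)\<close> and \<open>(b, a)\<close>: the six-vertex pattern,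
  with the weight of \<open>E\<^sub>a\<^sub>a \<otimes> E\<^sub>b\<^sub>b\<close> for \<open>a \<noteq> b\<close> normalized to 1.\<close>

definition six_vertex ::
  "complex \<Rightarrow> ('n \<Rightarrow> 'n \<Rightarrow> complex) \<Rightarrow> complex ^ ('n \<times> 'n) ^ ('n \<times> 'n::finite)" where
  "six_vertex \<alpha> \<gamma> = (\<chi> p s.
     if fst p = snd p then (if s = p then \<alpha> else 0)
     else (if s = p then 1 else 0) + (if s = prod.swap p then \<gamma> (fst p) (snd p) else 0))"

lemma scaleC_if_zero: "(if P then a else 0) *\<^sub>C (x :: 'a::complex_algebra_1) = (if P then a *\<^sub>C x else 0)"
  by (simp add: scaleC_zero_left)

lemma six_vertex_mult_entry:
  fixes X :: "'r::complex_algebra_1 ^ ('n \<times> 'n) ^ ('n \<times> 'n::finite)"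
  shows "(map_matrix (\<lambda>c. c *\<^sub>C 1) (six_vertex \<alpha> \<gamma>) ** X) $ (a, b) $ s
    = (if a = b then \<alpha> *\<^sub>C X $ (a, a) $ s else X $ (a, b) $ s + \<gamma> a b *\<^sub>C X $ (b, a) $ s)"
  by (simp add: matrix_matrix_mult_def six_vertex_def map_matrix_def mult_scaleC_left
      scaleC_add_left scaleC_if_zero sum.distrib sum.delta scaleC_one)

lemma mult_six_vertex_entry:
  fixes X :: "'r::complex_algebra_1 ^ ('n \<times> 'n) ^ ('n \<times> 'n::finite)"
  shows "(X ** map_matrix (\<lambda>c. c *\<^sub>C 1) (six_vertex \<alpha> \<gamma>)) $ p $ (c, d)
    = (if c = d then \<alpha> *\<^sub>C X $ p $ (c, c) else X $ p $ (c, d) + \<gamma> d c *\<^sub>C X $ p $ (d, c))"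
proof -
  \<comment> \<open>The same matrix read by columns.\<close>
  have col: "six_vertex \<alpha> \<gamma> $ t $ (c, d)
      = (if c = d then (if t = (c, c) then \<alpha> else 0)
         else (if t = (c, d) then 1 else 0) + (if t = (d, c) then \<gamma> d c else 0))" for t
    by (cases t) (auto simp: six_vertex_def)
  show ?thesis
    by (simp add: matrix_matrix_mult_def map_matrix_def col mult_scaleC_right
      scaleC_add_left scaleC_if_zero sum.distrib sum.delta scaleC_one)
qed

lemma leg1_leg2_entry:
  fixes A B :: "'r::ring_1 ^ 'n::finite ^ 'n"
  shows "(leg1 A ** leg2 B) $ (a, b) $ (c, d) = A $ a $ c * B $ b $ d"
proof -
  have "(leg1 A ** leg2 B) $ (a, b) $ (c, d)
      = (\<Sum>t\<in>UNIV. if t = (c, b) then A $ a $ c * B $ b $ d else 0)"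
    unfolding matrix_matrix_mult_def leg1_def leg2_def kronecker_def mat_def vec_lambda_beta
    by (rule sum.cong[OF refl]) auto
  then show ?thesis by simp
qed

lemma leg2_leg1_entry:
  fixes A B :: "'r::ring_1 ^ 'n::finite ^ 'n"
  shows "(leg2 B ** leg1 A) $ (a, b) $ (c, d) = B $ b $ d * A $ a $ c"
proof -
  have "(leg2 B ** leg1 A) $ (a, b) $ (c, d)
      = (\<Sum>t\<in>UNIV. if t = (a, d) then B $ b $ d * A $ a $ c else 0)"
    unfolding matrix_matrix_mult_def leg1_def leg2_def kronecker_def mat_def vec_lambda_beta
    by (rule sum.cong[OF refl]) auto
  then show ?thesis by simp
qed

lemma six_vertex_exchange_iff:
  fixes A B :: "'r::complex_algebra_1 ^ 'n::finite ^ 'n"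
  shows "map_matrix (\<lambda>c. c *\<^sub>C 1) (six_vertex \<alpha> \<gamma>) ** leg1 A ** leg2 B
      = leg2 B ** leg1 A ** map_matrix (\<lambda>c. c *\<^sub>C 1) (six_vertex \<alpha> \<gamma>) \<longleftrightarrow>
    (\<forall>a b c d.
      (if a = b then \<alpha> *\<^sub>C (A $ a $ c * B $ a $ d)
       else A $ a $ c * B $ b $ d + \<gamma> a b *\<^sub>C (A $ b $ c * B $ a $ d))
      = (if c = d then \<alpha> *\<^sub>C (B $ b $ c * A $ a $ c)
         else B $ b $ d * A $ a $ c + \<gamma> d c *\<^sub>C (B $ b $ c * A $ a $ d)))"
  unfolding matrix_mul_assoc[symmetric]
  unfolding matrix_mul_assoc[of "leg2 B"]
  by (simp add: vec_eq_iff split_paired_All six_vertex_mult_entry mult_six_vertex_entry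
      leg1_leg2_entry leg2_leg1_entry)

section \<open>The R-matrix at the inverse square of q\<close>

lemma kronecker_matrix_unit_entry:
  "(matrix_unit i j \<otimes>\<^sub>K matrix_unit k l :: complex ^ ('n \<times> 'n) ^ ('n \<times> 'n::finite)) $ (a, b) $ (c, d)
    = (if i = a \<and> j = c \<and> k = b \<and> l = d then 1 else 0)"
  by (auto simp: kronecker_def matrix_unit_def)

lemma trig_R_eq_six_vertex:
  assumes "z \<noteq> 1"
  shows "(trig_R q z :: complex ^ ('n \<times> 'n) ^ ('n \<times> 'n::{finite,linorder}))
    = six_vertex ((q * z - inverse q) / (z - 1))
        (\<lambda>a b. (q - inverse q) * (if a < b then z else 1) / (z - 1))"
proof -
  have diag: "(\<Sum>i\<in>UNIV. matrix_unit i i \<otimes>\<^sub>K matrix_unit i i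
        :: complex ^ ('n \<times> 'n) ^ ('n \<times> 'n)) $ (a, b) $ (c, d)
      = (if a = b \<and> a = c \<and> b = d then 1 else 0)" for a b c d
  proof -
    have "(\<Sum>i\<in>UNIV. matrix_unit i i \<otimes>\<^sub>K matrix_unit i i
          :: complex ^ ('n \<times> 'n) ^ ('n \<times> 'n)) $ (a, b) $ (c, d)
        = (\<Sum>i\<in>UNIV. if i = a then (if a = b \<and> a = c \<and> b = d then 1 else 0) else 0)"
      unfolding sum_component by (rule sum.cong[OF refl]) (auto simp: kronecker_matrix_unit_entry)
    then show ?thesis by simp
  qed
  have off: "(\<Sum>(i, j)\<in>{(i, j). i \<noteq> j}. matrix_unit i i \<otimes>\<^sub>K matrix_unit j j
        :: complex ^ ('n \<times> 'n) ^ ('n \<times> 'n)) $ (a, b) $ (c, d)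
      = (if a \<noteq> b \<and> a = c \<and> b = d then 1 else 0)" for a b c d
  proof -
    have "(\<Sum>(i, j)\<in>{(i, j). i \<noteq> j}. matrix_unit i i \<otimes>\<^sub>K matrix_unit j j
          :: complex ^ ('n \<times> 'n) ^ ('n \<times> 'n)) $ (a, b) $ (c, d)
        = (\<Sum>p\<in>{(i, j). i \<noteq> j}. if p = (a, b) then (if a = c \<and> b = d then 1 else 0) else 0)"
      unfolding sum_component
      by (rule sum.cong[OF refl]) (auto simp: kronecker_matrix_unit_entry split_beta)
    then show ?thesis by (simp add: sum.delta)
  qed
  have perm: "(\<Sum>(i, j)\<in>{(i, j). i < j}. map_matrix ((*) z) (matrix_unit i j \<otimes>\<^sub>K matrix_unit j i)
          + matrix_unit j i \<otimes>\<^sub>K matrix_unit i j :: complex ^ ('n \<times> 'n) ^ ('n \<times> 'n)) $ (a, b) $ (c, d)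
      = (if a \<noteq> b \<and> a = d \<and> b = c then (if a < b then z else 1) else 0)" for a b c d
  proof -
    have "(\<Sum>(i, j)\<in>{(i, j). i < j}. map_matrix ((*) z) (matrix_unit i j \<otimes>\<^sub>K matrix_unit j i)
            + matrix_unit j i \<otimes>\<^sub>K matrix_unit i j :: complex ^ ('n \<times> 'n) ^ ('n \<times> 'n)) $ (a, b) $ (c, d)
        = (\<Sum>p\<in>{(i, j). i < j}. (if p = (a, b) then (if a = d \<and> b = c then z else 0) else 0)
            + (if p = (b, a) then (if a = d \<and> b = c then 1 else 0) else 0))"
      unfolding sum_component
    proof (rule sum.cong[OF refl], clarify)
      fix i j :: 'n
      show "(map_matrix ((*) z) (matrix_unit i j \<otimes>\<^sub>K matrix_unit j i)
            + matrix_unit j i \<otimes>\<^sub>K matrix_unit i j :: complex ^ ('n \<times> 'n) ^ ('n \<times> 'n)) $ (a, b) $ (c, d)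
          = (if (i, j) = (a, b) then (if a = d \<and> b = c then z else 0) else 0)
            + (if (i, j) = (b, a) then (if a = d \<and> b = c then 1 else 0) else 0)"
        unfolding vector_add_component map_matrix_def vec_lambda_beta kronecker_matrix_unit_entry
        by (intro arg_cong2[where f = "(+)"]) auto
    qed
    also have "\<dots> = (if a \<noteq> b \<and> a = d \<and> b = c then (if a < b then z else 1) else 0)"
      by (simp only: sum.distrib sum.delta[OF finite] mem_Collect_eq case_prod_conv)
        (cases a b rule: linorder_cases, auto)
    finally show ?thesis .
  qed
  have map_entry: "map_matrix f X $ p $ s = f (X $ p $ s)"
    for f and X :: "complex ^ ('n \<times> 'n) ^ ('n \<times> 'n)" and p s
    by (simp add: map_matrix_def)
  have entry: "trig_R q z $ (a, b) $ (c, d) = 1 / (z - 1) *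
      ((q * z - inverse q) * (if a = b \<and> a = c \<and> b = d then 1 else 0)
       + (z - 1) * (if a \<noteq> b \<and> a = c \<and> b = d then 1 else 0)
       + (q - inverse q) * (if a \<noteq> b \<and> a = d \<and> b = c then if a < b then z else 1 else 0))"
    for a b c d :: 'n
    by (simp only: trig_R_def map_entry vector_add_component diag off perm)
  have "trig_R q z $ (a, b) $ (c, d) = six_vertex ((q * z - inverse q) / (z - 1))
        (\<lambda>a b. (q - inverse q) * (if a < b then z else 1) / (z - 1)) $ (a, b) $ (c, d)"
    for a b c d :: 'n
  proof (cases "a = b")
    case True
    then show ?thesis by (auto simp: entry six_vertex_def)
  next
    case False
    have z: "z - 1 \<noteq> 0" using assms by simp
    consider (same) "c = a" "d = b" | (swapped) "c = b" "d = a"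
      | (other) "\<not> (a = c \<and> b = d)" "\<not> (a = d \<and> b = c)"
      by blast
    then show ?thesis
    proof cases
      case same
      with False z show ?thesis by (simp add: entry six_vertex_def)
    next
      case swapped
      with False show ?thesis by (simp add: entry six_vertex_def)
    next
      case other
      then have "(c, d) \<noteq> (a, b)" "(c, d) \<noteq> (b, a)" by auto
      with False other show ?thesis
        unfolding entry six_vertex_def by (simp only: vec_lambda_beta fst_conv snd_conv swap_simp) simp
    qed
  qed
  then show ?thesis
    unfolding vec_eq_iff split_paired_All by blast
qed

lemma tendsto_six_vertex:
  assumes "(\<alpha> \<longlongrightarrow> \<alpha>') F" "\<And>a b. ((\<lambda>z. \<gamma> z a b) \<longlongrightarrow> \<gamma>' a b) F"
  shows "((\<lambda>z. six_vertex (\<alpha> z) (\<gamma> z)) \<longlongrightarrow> six_vertex \<alpha>' \<gamma>') F"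
  unfolding six_vertex_def
  by (intro vec_tendstoI) (auto intro!: tendsto_eq_intros assms)

text \<open>Up to normalization, the projection onto the span of
  \<open>e\<^sub>a \<otimes> e\<^sub>b - q e\<^sub>b \<otimes> e\<^sub>a\<close> for \<open>a < b\<close>.\<close>

definition q_antisymmetrizer :: "complex \<Rightarrow> complex ^ ('n \<times> 'n) ^ ('n \<times> 'n::{finite,linorder})" where
  "q_antisymmetrizer q = six_vertex 0 (\<lambda>a b. if a < b then - inverse q else - q)"

text \<open>The value is that of the rational function, since \<open>q x - q\<^bsup>-1\<^esup> = 0\<close> and
  \<open>(q - q\<^bsup>-1\<^esup>) / (x - 1) = - q\<close> at \<open>x = q\<^bsup>-2\<^esup>\<close>.\<close>

lemma trig_R_tendsto_generic:
  assumes "q \<noteq> 0" "q\<^sup>2 \<noteq> 1"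
  shows "(trig_R q \<longlongrightarrow> (q_antisymmetrizer q :: complex ^ ('n \<times> 'n) ^ ('n \<times> 'n::{finite,linorder})))
    (at (inverse (q\<^sup>2)))"
proof -
  let ?x = "inverse (q\<^sup>2)"
  have x: "?x \<noteq> 1" using assms by (metis inverse_eq_1_iff)
  have "\<forall>\<^sub>F z in at ?x. z \<noteq> 1"
    using tendsto_imp_eventually_ne[OF tendsto_ident_at x] .
  then have eq: "\<forall>\<^sub>F z in at ?x. six_vertex ((q * z - inverse q) / (z - 1))
        (\<lambda>a b :: 'n. (q - inverse q) * (if a < b then z else 1) / (z - 1)) = trig_R q z"
    by eventually_elim (simp add: trig_R_eq_six_vertex)
  have qx: "q * ?x = inverse q"
    using assms by (simp add: power2_eq_square)
  have \<alpha>: "(q * ?x - inverse q) / (?x - 1) = 0"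
    using qx by simp
  have \<gamma>: "(q - inverse q) * (if a < b then ?x else 1) / (?x - 1)
      = (if a < b then - inverse q else - q)" for a b :: 'n
  proof -
    have "(q - inverse q) / (?x - 1) = - q"
      using x qx by (simp add: nonzero_divide_eq_eq right_diff_distrib)
    moreover have "- q * ?x = - inverse q"
      using qx by simp
    ultimately show ?thesis
      by (simp only: times_divide_eq_left[symmetric] mult_1_right mult.commute[of _ ?x] split: if_split)
        (simp add: mult.commute)
  qed
  have "((\<lambda>z. six_vertex ((q * z - inverse q) / (z - 1))
        (\<lambda>a b :: 'n. (q - inverse q) * (if a < b then z else 1) / (z - 1)))
      \<longlongrightarrow> q_antisymmetrizer q) (at ?x)"
    unfolding q_antisymmetrizer_def
  proof (rule tendsto_six_vertex)
    show "((\<lambda>z. (q * z - inverse q) / (z - 1)) \<longlongrightarrow> 0) (at ?x)"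
      unfolding \<alpha>[symmetric] using x by (intro tendsto_intros) auto
    show "((\<lambda>z. (q - inverse q) * (if a < b then z else 1) / (z - 1))
        \<longlongrightarrow> (if a < b then - inverse q else - q)) (at ?x)" for a b :: 'n
      unfolding \<gamma>[symmetric] using x by (cases "a < b") (auto intro!: tendsto_intros)
  qed
  then show ?thesis
    using eq by (rule Lim_transform_eventually)
qed

text \<open>Now \<open>q = q\<^bsup>-1\<^esup>\<close>, so the off-diagonal terms are absent and the factor \<open>z - 1\<close> cancels.\<close>

lemma trig_R_tendsto_removable:
  assumes "q\<^sup>2 = 1"
  shows "(trig_R q \<longlongrightarrow>
    (six_vertex q (\<lambda>_ _. 0) :: complex ^ ('n \<times> 'n) ^ ('n \<times> 'n::{finite,linorder}))) (at 1)"
proof (rule tendsto_eventually)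
  have q: "inverse q = q"
    using assms by (metis inverse_unique power2_eq_square)
  have "trig_R q z = (six_vertex q (\<lambda>_ _. 0) :: complex ^ ('n \<times> 'n) ^ ('n \<times> 'n))"
    if "z \<noteq> 1" for z
  proof -
    have "(q * z - q) / (z - 1) = q"
      using that by (simp add: field_simps)
    then show ?thesis
      using that by (simp add: trig_R_eq_six_vertex q)
  qed
  then show "\<forall>\<^sub>F z in at 1.
      trig_R q z = (six_vertex q (\<lambda>_ _. 0) :: complex ^ ('n \<times> 'n) ^ ('n \<times> 'n))"
    by (simp add: eventually_at_filter)
qed

section \<open>The q-Manin relations of an L-operator\<close>

text \<open>For \<open>q\<^sup>2 \<noteq> 1\<close> this is the defining relation at the pair of arguments with quotient
  \<open>q\<^bsup>-2\<^esup>\<close>. For \<open>q\<^sup>2 = 1\<close> the two arguments coincide and the defining relation has a diagonal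
  matrix instead; its entries with \<open>a = b\<close> or \<open>c = d\<close> say that the entries of a row or of a
  column commute up to the sign \<open>q\<close>, the others are commutators, and both are combined into the
  entries of the relation with the antisymmetrizer.\<close>

lemma L_operator_antisymmetrizer:
  fixes L :: "complex \<Rightarrow> 'r::complex_algebra_1 ^ 'n::{finite,linorder} ^ 'n::{finite,linorder}"
  assumes L: "L_operator q D L" and "q \<noteq> 0" "z \<in> D" "q\<^sup>2 * z \<in> D" "z \<noteq> 0"
  shows "map_matrix (\<lambda>c. c *\<^sub>C 1) (q_antisymmetrizer q) ** leg1 (L z) ** leg2 (L (q\<^sup>2 * z))
    = leg2 (L (q\<^sup>2 * z)) ** leg1 (L z) ** map_matrix (\<lambda>c. c *\<^sub>C 1) (q_antisymmetrizer q)"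
proof -
  have x: "z / (q\<^sup>2 * z) = inverse (q\<^sup>2)"
    using assms by (simp add: field_simps)
  have RLL: "map_matrix (\<lambda>c. c *\<^sub>C 1) C ** leg1 (L z) ** leg2 (L (q\<^sup>2 * z))
      = leg2 (L (q\<^sup>2 * z)) ** leg1 (L z) ** map_matrix (\<lambda>c. c *\<^sub>C 1) C"
    if "(trig_R q \<longlongrightarrow> C) (at (inverse (q\<^sup>2)))" for C
    using L that assms(3,4) unfolding L_operator_def x[symmetric] by blast
  show ?thesis
  proof (cases "q\<^sup>2 = 1")
    case False
    then show ?thesis
      using RLL trig_R_tendsto_generic assms(2) by blast
  next
    case True
    then have q: "inverse q = q"
      by (metis inverse_unique power2_eq_square)
    define A where "A = L z"
    have "(trig_R q \<longlongrightarrow> (six_vertex q (\<lambda>_ _. 0) :: complex ^ ('n \<times> 'n) ^ ('n \<times> 'n)))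
        (at (inverse (q\<^sup>2)))"
      using trig_R_tendsto_removable[OF True] True by simp
    note RLL_diag = RLL[OF this, unfolded six_vertex_exchange_iff True mult_1_left, rule_format]
    have ex: "(if a = b then q *\<^sub>C (A $ a $ c * A $ a $ d) else A $ a $ c * A $ b $ d)
        = (if c = d then q *\<^sub>C (A $ b $ c * A $ a $ c) else A $ b $ d * A $ a $ c)" for a b c d
      using RLL_diag[of a b c d] unfolding A_def by (simp only: scaleC_zero_left add_0_right)
    have row: "A $ a $ d * A $ a $ c = q *\<^sub>C (A $ a $ c * A $ a $ d)" if "c \<noteq> d" for a c d
      using ex[of a a c d] that by simp
    have col: "A $ a $ c * A $ b $ c = q *\<^sub>C (A $ b $ c * A $ a $ c)" if "a \<noteq> b" for a b c
      using ex[of a b c c] that by simp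
    have cross: "A $ a $ c * A $ b $ d = A $ b $ d * A $ a $ c" if "a \<noteq> b" "c \<noteq> d" for a b c d
      using ex[of a b c d] that by simp
    have "(if a = b then 0 else A $ a $ c * A $ b $ d - q *\<^sub>C (A $ b $ c * A $ a $ d))
        = (if c = d then 0 else A $ b $ d * A $ a $ c - q *\<^sub>C (A $ b $ c * A $ a $ d))" for a b c d
      using row[of c d a] col[of a b c] cross[of a b c d] by auto
    then show ?thesis
      unfolding q_antisymmetrizer_def six_vertex_exchange_iff True mult_1_left A_def[symmetric] q
      by (simp only: scaleC_zero_left scaleC_minus_left if_cancel diff_conv_add_uminus) blast
  qed
qed

text \<open>The positions \<open>(a, b), (c, c)\<close> and \<open>(a, a), (c, d)\<close> involve only one side of the exchange
  relation and give the first two claims. At \<open>(a, b), (c, d)\<close> and \<open>(a, b), (d, c)\<close> the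
  right-hand sides differ by the factor \<open>- q\<^bsup>-1\<^esup>\<close>, since they are entries of
  proportional columns, so that a linear combination of these two entries is a relation between the
  products in the order \<open>A\<close>, \<open>B\<close> alone. At \<open>(a, b), (c, d)\<close> and \<open>(b, a), (c, d)\<close> the same holds
  for the left-hand sides with the factor \<open>- q\<close>.\<close>

lemma antisymmetrizer_relations:
  fixes A B :: "'r::complex_algebra_1 ^ 'n::{finite,linorder} ^ 'n::{finite,linorder}"
  assumes q: "q \<noteq> 0"
    and exchange: "map_matrix (\<lambda>c. c *\<^sub>C 1) (q_antisymmetrizer q) ** leg1 A ** leg2 B
      = leg2 B ** leg1 A ** map_matrix (\<lambda>c. c *\<^sub>C 1) (q_antisymmetrizer q)"
  shows antisymmetrizer_column:
      "a < b \<Longrightarrow> A $ a $ c * B $ b $ c = inverse q *\<^sub>C (A $ b $ c * B $ a $ c)"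
    and antisymmetrizer_row:
      "c < d \<Longrightarrow> B $ a $ c * A $ a $ d = inverse q *\<^sub>C (B $ a $ d * A $ a $ c)"
    and antisymmetrizer_cross_left: "a < b \<Longrightarrow> c < d \<Longrightarrow>
      A $ a $ c * B $ b $ d - A $ b $ d * B $ a $ c
        = inverse q *\<^sub>C (A $ b $ c * B $ a $ d) - q *\<^sub>C (A $ a $ d * B $ b $ c)"
    and antisymmetrizer_cross_right: "a < b \<Longrightarrow> c < d \<Longrightarrow>
      B $ a $ c * A $ b $ d - B $ b $ d * A $ a $ c
        = inverse q *\<^sub>C (B $ a $ d * A $ b $ c) - q *\<^sub>C (B $ b $ c * A $ a $ d)"
proof -
  have ex: "(if a = b then 0
       else A $ a $ c * B $ b $ d - (if a < b then inverse q else q) *\<^sub>C (A $ b $ c * B $ a $ d))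
      = (if c = d then 0
         else B $ b $ d * A $ a $ c - (if d < c then inverse q else q) *\<^sub>C (B $ b $ c * A $ a $ d))"
    for a b c d
    using exchange[unfolded q_antisymmetrizer_def six_vertex_exchange_iff, rule_format, of a b c d]
    by (simp only: scaleC_zero_left scaleC_minus_left diff_conv_add_uminus
        if_distrib[of "\<lambda>s. s *\<^sub>C _"] if_distrib[of uminus] cong: if_cong)
  show "A $ a $ c * B $ b $ c = inverse q *\<^sub>C (A $ b $ c * B $ a $ c)" if "a < b"
    using ex[of a b c c] that less_imp_neq[OF that] by simp
  show "B $ a $ c * A $ a $ d = inverse q *\<^sub>C (B $ a $ d * A $ a $ c)" if "c < d"
    using ex[of a a d c] that less_imp_neq[OF that] by simp
  have eliminate: "u - t = v - w" if "u - v = x - y" "w - t = y - x" for t u v w x y :: 'r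
  proof -
    have "u - t = (u - v) + (w - t) + (v - w)" by simp
    also have "\<dots> = v - w" unfolding that by simp
    finally show ?thesis .
  qed
  {
    assume less: "a < b" "c < d"
    have ac: "A $ a $ c * B $ b $ d - inverse q *\<^sub>C (A $ b $ c * B $ a $ d)
        = B $ b $ d * A $ a $ c - q *\<^sub>C (B $ b $ c * A $ a $ d)"
      and ad: "A $ a $ d * B $ b $ c - inverse q *\<^sub>C (A $ b $ d * B $ a $ c)
        = B $ b $ c * A $ a $ d - inverse q *\<^sub>C (B $ b $ d * A $ a $ c)"
      and bc: "A $ b $ c * B $ a $ d - q *\<^sub>C (A $ a $ c * B $ b $ d)
        = B $ a $ d * A $ b $ c - q *\<^sub>C (B $ a $ c * A $ b $ d)"
      using ex[of a b c d] ex[of a b d c] ex[of b a c d] less less[THEN less_imp_neq]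
        less[THEN less_not_sym] by auto
    from arg_cong[OF ad, of "\<lambda>x. q *\<^sub>C x"]
    have "q *\<^sub>C (A $ a $ d * B $ b $ c) - A $ b $ d * B $ a $ c
        = q *\<^sub>C (B $ b $ c * A $ a $ d) - B $ b $ d * A $ a $ c"
      using q by (simp add: scaleC_diff_right scaleC_scaleC scaleC_one)
    from eliminate[OF ac this] show "A $ a $ c * B $ b $ d - A $ b $ d * B $ a $ c
        = inverse q *\<^sub>C (A $ b $ c * B $ a $ d) - q *\<^sub>C (A $ a $ d * B $ b $ c)" .
    from arg_cong[OF bc, of "\<lambda>x. inverse q *\<^sub>C x"]
    have "inverse q *\<^sub>C (A $ b $ c * B $ a $ d) - A $ a $ c * B $ b $ d
        = inverse q *\<^sub>C (B $ a $ d * A $ b $ c) - B $ a $ c * A $ b $ d"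
      using q by (simp add: scaleC_diff_right scaleC_scaleC scaleC_one)
    from eliminate[OF ac[symmetric] this[symmetric]]
    show "B $ a $ c * A $ b $ d - B $ b $ d * A $ a $ c
        = inverse q *\<^sub>C (B $ a $ d * A $ b $ c) - q *\<^sub>C (B $ b $ c * A $ a $ d)"
      by (metis minus_diff_eq)
  }
qed

theorem proposition6p2:
  fixes q :: complex and D :: "complex set"
    and L :: "complex \<Rightarrow> 'r::complex_algebra_1 ^ 'n::{finite,linorder} ^ 'n::{finite,linorder}"
  assumes "q \<noteq> 0"
    and "0 \<notin> D" and "\<And>z. q\<^sup>2 * z \<in> D \<longleftrightarrow> z \<in> D"
    and "L_operator q D L"
  shows "q_manin q (op_matrix D L (q\<^sup>2))
       \<and> q_manin q (op_matrix D (\<lambda>z. transpose (L z)) (inverse (q\<^sup>2)))"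
proof
  have exchange: "map_matrix (\<lambda>c. c *\<^sub>C 1) (q_antisymmetrizer q) ** leg1 (L z) ** leg2 (L (q\<^sup>2 * z))
      = leg2 (L (q\<^sup>2 * z)) ** leg1 (L z) ** map_matrix (\<lambda>c. c *\<^sub>C 1) (q_antisymmetrizer q)"
    if "z \<in> D" for z
    using assms that by (intro L_operator_antisymmetrizer) auto
  show "q_manin q (op_matrix D L (q\<^sup>2))"
    using antisymmetrizer_column[OF assms(1) exchange] antisymmetrizer_cross_left[OF assms(1) exchange]
    by (intro q_manin_op_matrixI assms(3))
  have cancel: "q\<^sup>2 * (inverse (q\<^sup>2) * z) = z" for z
    using assms(1) by simp
  have D: "inverse (q\<^sup>2) * z \<in> D \<longleftrightarrow> z \<in> D" for z
    using assms(3)[of "inverse (q\<^sup>2) * z"] unfolding cancel by simp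
  \<comment> \<open>Here the second factor of a product is evaluated at \<open>q\<^bsup>-2\<^esup> z\<close>, so the products are those of
    the right-hand side of the exchange relation at that point.\<close>
  have exchange': "map_matrix (\<lambda>c. c *\<^sub>C 1) (q_antisymmetrizer q)
        ** leg1 (L (inverse (q\<^sup>2) * z)) ** leg2 (L z)
      = leg2 (L z) ** leg1 (L (inverse (q\<^sup>2) * z))
        ** map_matrix (\<lambda>c. c *\<^sub>C 1) (q_antisymmetrizer q)" if "z \<in> D" for z
    using exchange[of "inverse (q\<^sup>2) * z"] that unfolding cancel D by simp
  show "q_manin q (op_matrix D (\<lambda>z. transpose (L z)) (inverse (q\<^sup>2)))"
  proof (rule q_manin_op_matrixI[OF D])
    fix z and i k j l :: 'n
    assume "z \<in> D" "i < k"
    note rels = antisymmetrizer_row[OF assms(1) exchange'[OF \<open>z \<in> D\<close>] \<open>i < k\<close>]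
      antisymmetrizer_cross_right[OF assms(1) exchange'[OF \<open>z \<in> D\<close>] _ \<open>i < k\<close>]
    show "transpose (L z) $ i $ j * transpose (L (inverse (q\<^sup>2) * z)) $ k $ j
        = inverse q *\<^sub>C (transpose (L z) $ k $ j * transpose (L (inverse (q\<^sup>2) * z)) $ i $ j)"
      unfolding transpose_def vec_lambda_beta by (rule rels)
    assume "j < l"
    show "transpose (L z) $ i $ j * transpose (L (inverse (q\<^sup>2) * z)) $ k $ l
          - transpose (L z) $ k $ l * transpose (L (inverse (q\<^sup>2) * z)) $ i $ j
        = inverse q *\<^sub>C (transpose (L z) $ k $ j * transpose (L (inverse (q\<^sup>2) * z)) $ i $ l)
          - q *\<^sub>C (transpose (L z) $ i $ l * transpose (L (inverse (q\<^sup>2) * z)) $ k $ j)"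
      unfolding transpose_def vec_lambda_beta by (rule rels(2)[OF \<open>j < l\<close>])
  qed
qed

end
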